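(* Let $G$ be a connected graph on $n$ vertices and let $1\le c\le n$. Then $$M_c(G)\ \le\ n-\left\lceil \frac{n}{c}\right\rceil .$$
   Context: All graphs are finite and simple. The (free) Flood-It game: let $G=(V,E)$ be a graph with a colouring $\omega:V\to C$, not necessarily proper, where $C$ is a finite colour-set. A monochromatic component is a maximal set of vertices of one colour inducing a connected subgraph. A move $(v,d)$, with $v\in V$ and $d\in C$, recolours with colour $d$ every vertex in the monochromatic component (with respect to the current colouring) containing $v$. For $d\in C$, $m(G,\omega,d)$ is the minimum number of moves needed, starting from $\omega$, to give all vertices of $G$ colour $d$, and $m(G,\omega)=\min_{d\in C}m(G,\omega,d)$. For a positive integer $c\le |V|$, $M_c(G)=\max_\omega m(G,\omega)$, where the maximum is over all surjective colourings $\omega:V\to\{1,\dots,c\}$ (with colour-set $C=\{1,\dots,c\}$). *)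

theory Defs
  imports "Graph_Theory.Digraph_Component" "HOL-Library.FuncSet" "HOL-Library.Extended_Nat" Complex_Main
begin

text \<open>A finite simple graph is an instance of \<^locale>\<open>graph\<close>: each undirected edge is
  represented by its two opposite arcs. Note that \<^const>\<open>connected\<close> excludes the empty graph.\<close>

definition monochromatic_connected ::
    "('a, 'b) pre_digraph \<Rightarrow> ('a \<Rightarrow> 'c) \<Rightarrow> 'a set \<Rightarrow> bool" where
  "monochromatic_connected G \<omega> S \<longleftrightarrow>
     S \<subseteq> verts G \<and> (\<exists>d. \<forall>u\<in>S. \<omega> u = d) \<and> connected (G \<restriction> S)"

definition monochromatic_component ::
    "('a, 'b) pre_digraph \<Rightarrow> ('a \<Rightarrow> 'c) \<Rightarrow> 'a set \<Rightarrow> bool" where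
  "monochromatic_component G \<omega> S \<longleftrightarrow>
     monochromatic_connected G \<omega> S \<and>
     (\<forall>T. monochromatic_connected G \<omega> T \<and> S \<subseteq> T \<longrightarrow> T = S)"

definition flood_move ::
    "('a, 'b) pre_digraph \<Rightarrow> 'a \<times> 'c \<Rightarrow> ('a \<Rightarrow> 'c) \<Rightarrow> ('a \<Rightarrow> 'c)" where
  "flood_move G = (\<lambda>(v, d) \<omega> u.
     if \<exists>S. monochromatic_component G \<omega> S \<and> v \<in> S \<and> u \<in> S then d else \<omega> u)"

definition flood_moves ::
    "('a, 'b) pre_digraph \<Rightarrow> ('a \<times> 'c) list \<Rightarrow> ('a \<Rightarrow> 'c) \<Rightarrow> ('a \<Rightarrow> 'c)" where
  "flood_moves G ms = fold (flood_move G) ms"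

text \<open>The number of moves is taken in \<^typ>\<open>enat\<close>, so that it is \<open>\<infinity>\<close> rather than
  a junk value if no sequence of moves reaches the target colour.\<close>

definition flood_number_to ::
    "('a, 'b) pre_digraph \<Rightarrow> 'c set \<Rightarrow> ('a \<Rightarrow> 'c) \<Rightarrow> 'c \<Rightarrow> enat" where
  "flood_number_to G C \<omega> d =
     (INF ms \<in> {ms. set ms \<subseteq> verts G \<times> C \<and> (\<forall>u\<in>verts G. flood_moves G ms \<omega> u = d)}.
        enat (length ms))"

definition flood_number ::
    "('a, 'b) pre_digraph \<Rightarrow> 'c set \<Rightarrow> ('a \<Rightarrow> 'c) \<Rightarrow> enat" where
  "flood_number G C \<omega> = (INF d \<in> C. flood_number_to G C \<omega> d)"

text \<open>For \<open>1 \<le> c \<le> card (verts G)\<close> the supremum is over a finite nonempty set, so it is the maximum.\<close>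

definition max_flood_number :: "nat \<Rightarrow> ('a, 'b) pre_digraph \<Rightarrow> enat" where
  "max_flood_number c G =
     (SUP \<omega> \<in> {\<omega> \<in> verts G \<rightarrow>\<^sub>E {1..c}. \<omega> ` verts G = {1..c}}. flood_number G {1..c} \<omega>)"

end

theory Submission
  imports Defs
begin

text \<open>By pigeonhole some colour \<open>d\<close> is held by at least \<open>n / c\<close> vertices. Every move that gives
  colour \<open>d\<close> to a vertex not yet of colour \<open>d\<close> strictly decreases the number of such vertices,
  so at most \<open>n - \<lceil>n / c\<rceil>\<close> moves make the whole graph of colour \<open>d\<close>.\<close>

text \<open>\<open>flood_move\<close> changes \<open>v\<close> only if some component contains
  \<open>v\<close>, so existence must be secured. The singleton of \<open>v\<close> is monochromatic
  and connected, and a finite family of sets has a maximal member above it.\<close>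

lemma monochromatic_component_exists:
  assumes "graph G" and v: "v \<in> verts G"
  obtains S where "monochromatic_component G \<omega> S" "v \<in> S"
proof -
  interpret graph G by fact
  have "connected (G \<restriction> {v})"
    by (auto simp: connected_def strongly_connected_def reachable_def rtrancl_on_refl)
  with v have "monochromatic_connected G \<omega> {v}"
    by (auto simp: monochromatic_connected_def)
  moreover have "finite {S. monochromatic_connected G \<omega> S}"
    by (rule finite_subset[of _ "Pow (verts G)"]) (auto simp: monochromatic_connected_def)
  ultimately obtain S where "{v} \<subseteq> S" "monochromatic_connected G \<omega> S"
      "\<forall>T. monochromatic_connected G \<omega> T \<and> S \<subseteq> T \<longrightarrow> S = T"
    using finite_has_maximal2[of "{S. monochromatic_connected G \<omega> S}" "{v}"] by auto
  then show ?thesis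
    by (intro that[of S]) (auto simp: monochromatic_component_def)
qed

text \<open>Greedy play: keep choosing a vertex not coloured \<open>d\<close> and flood its
  component with \<open>d\<close>. The induction ranges over all colourings, since each move
  produces a new one.\<close>

lemma flood_moves_to_colour:
  assumes "graph G"
  shows "\<exists>ms. set ms \<subseteq> verts G \<times> {d} \<and> (\<forall>u\<in>verts G. flood_moves G ms \<omega> u = d) \<and>
    length ms \<le> card {u \<in> verts G. \<omega> u \<noteq> d}"
proof (induction "card {u \<in> verts G. \<omega> u \<noteq> d}" arbitrary: \<omega> rule: less_induct)
  case less
  interpret graph G by fact
  show ?case
  proof (cases "\<forall>u\<in>verts G. \<omega> u = d")
    case True
    then show ?thesis by (intro exI[of _ "[]"]) (simp add: flood_moves_def)
  next
    case False
    then obtain v where v: "v \<in> verts G" "\<omega> v \<noteq> d" by blast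
    define \<omega>' where "\<omega>' = flood_move G (v, d) \<omega>"
    obtain S where "monochromatic_component G \<omega> S" "v \<in> S"
      using monochromatic_component_exists[OF \<open>graph G\<close> v(1)] .
    then have "\<omega>' v = d" by (auto simp: \<omega>'_def flood_move_def)
    \<comment> \<open>A move with colour \<open>d\<close> either sets a vertex to \<open>d\<close>
      or leaves it alone, so no progress is lost; \<open>v\<close> itself makes the decrease
      strict.\<close>
    moreover have "\<omega>' u = d" if "\<omega> u = d" for u
      using that by (simp add: \<omega>'_def flood_move_def)
    ultimately have "{u \<in> verts G. \<omega>' u \<noteq> d} \<subset> {u \<in> verts G. \<omega> u \<noteq> d}"
      using v by blast
    then have lt: "card {u \<in> verts G. \<omega>' u \<noteq> d} < card {u \<in> verts G. \<omega> u \<noteq> d}"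
      by (intro psubset_card_mono) auto
    then obtain ms where "set ms \<subseteq> verts G \<times> {d}" "\<forall>u\<in>verts G. flood_moves G ms \<omega>' u = d"
        "length ms \<le> card {u \<in> verts G. \<omega>' u \<noteq> d}"
      using less by blast
    then show ?thesis
      \<comment> \<open>\<open>fold\<close> plays the head of the list first, so \<open>ms\<close>
        then starts from \<open>\<omega>'\<close>. The strict decrease pays for the extra
        move.\<close>
      using v lt by (intro exI[of _ "(v, d) # ms"]) (auto simp: flood_moves_def \<omega>'_def)
  qed
qed

text \<open>Both infima, over target colours and over move lists, are bounded by any single witness;
  \<open>d \<in> C\<close> makes the greedy moves admissible.\<close>

lemma flood_number_le_card_other_colours:
  assumes "graph G" and "d \<in> C"
  shows "flood_number G C \<omega> \<le> enat (card {u \<in> verts G. \<omega> u \<noteq> d})"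
proof -
  obtain ms where ms: "set ms \<subseteq> verts G \<times> {d}" "\<forall>u\<in>verts G. flood_moves G ms \<omega> u = d"
      "length ms \<le> card {u \<in> verts G. \<omega> u \<noteq> d}"
    using flood_moves_to_colour[OF \<open>graph G\<close>, of d \<omega>] by blast
  have "flood_number G C \<omega> \<le> flood_number_to G C \<omega> d"
    unfolding flood_number_def using \<open>d \<in> C\<close> by (rule INF_lower)
  also have "\<dots> \<le> enat (length ms)"
    unfolding flood_number_to_def using ms \<open>d \<in> C\<close> by (intro INF_lower) auto
  also have "\<dots> \<le> enat (card {u \<in> verts G. \<omega> u \<noteq> d})"
    using ms by simp
  finally show ?thesis .
qed

text \<open>Pigeonhole: a largest colour class is at least of average size. The product form avoids
  division.\<close>

lemma exists_large_colour_class: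
  assumes "finite V" "finite C" "C \<noteq> {}" "\<omega> ` V \<subseteq> C"
  obtains d where "d \<in> C" "card V \<le> card C * card {u \<in> V. \<omega> u = d}"
proof -
  have "card V = (\<Sum>d\<in>C. card {u \<in> V. \<omega> u = d})"
    \<comment> \<open>Summing the constant 1 over the fibres of \<open>\<omega>\<close> counts
      \<open>V\<close>.\<close>
    using sum.group[of V C \<omega> "\<lambda>_. 1::nat"] assms by simp
  also have "\<dots> \<le> card C * Max ((\<lambda>d. card {u \<in> V. \<omega> u = d}) ` C)"
    using assms sum_bounded_above[of C "\<lambda>d. card {u \<in> V. \<omega> u = d}"] by simp
  finally have *: "card V \<le> card C * Max ((\<lambda>d. card {u \<in> V. \<omega> u = d}) ` C)" .
  obtain d where "d \<in> C"
      "Max ((\<lambda>d. card {u \<in> V. \<omega> u = d}) ` C) = card {u \<in> V. \<omega> u = d}"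
    using Max_in[of "(\<lambda>d. card {u \<in> V. \<omega> u = d}) ` C"] assms by blast
  with * show ?thesis
    by (intro that[of d]) simp_all
qed

theorem proposition2p8:
  fixes G :: "('a, 'b) pre_digraph" and n c :: nat
  assumes "graph G" and "connected G"
    and "card (verts G) = n"
    and "1 \<le> c" and "c \<le> n"
  shows "max_flood_number c G \<le> enat (n - nat \<lceil>real n / real c\<rceil>)"
  unfolding max_flood_number_def
proof (rule SUP_least)
  interpret graph G by fact
  fix \<omega> assume "\<omega> \<in> {\<omega> \<in> verts G \<rightarrow>\<^sub>E {1..c}. \<omega> ` verts G = {1..c}}"
  then obtain d where d: "d \<in> {1..c}" "n \<le> c * card {u \<in> verts G. \<omega> u = d}"
    using exists_large_colour_class[of "verts G" "{1..c}" \<omega>] assms by auto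
  from d(2) have "real n \<le> real c * real (card {u \<in> verts G. \<omega> u = d})"
    by (metis of_nat_le_iff of_nat_mult)
  \<comment> \<open>The class size is an integer, so being at least \<open>n / c\<close> it is also
    at least the ceiling.\<close>
  then have "nat \<lceil>real n / real c\<rceil> \<le> card {u \<in> verts G. \<omega> u = d}"
    using \<open>1 \<le> c\<close> by (simp add: ceiling_le_iff divide_le_eq mult.commute)
  moreover have "card {u \<in> verts G. \<omega> u \<noteq> d} = n - card {u \<in> verts G. \<omega> u = d}"
  proof -
    have "{u \<in> verts G. \<omega> u \<noteq> d} = verts G - {u \<in> verts G. \<omega> u = d}" by auto
    then show ?thesis using assms by (simp add: card_Diff_subset)
  qed
  ultimately have "enat (card {u \<in> verts G. \<omega> u \<noteq> d}) \<le> enat (n - nat \<lceil>real n / real c\<rceil>)"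
    by (simp only: enat_ord_simps diff_le_mono2)
  with flood_number_le_card_other_colours[OF \<open>graph G\<close> d(1)]
  show "flood_number G {1..c} \<omega> \<le> enat (n - nat \<lceil>real n / real c\<rceil>)"
    by (rule order_trans)
qed

end
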